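(* For $k\ge3$ and $n\ge2$, $$p_n(\Sigma_k)-p_n(\Sigma_{k-1})=C(n,k)=L_k(n)-\sum_{i=2}^{k-1}\binom{n+k-i}{k-i}C(n,i),$$ where $L_k(n)=\frac1n\sum_{d\mid n}\mu(d)k^{n/d}$ and $\mu$ is the Möbius function.
   Context: For $\sigma\in\{+,-\}^k$ ($k\ge2$), let $\mathcal W_k$ be the set of infinite words over $\{0,\dots,k-1\}$ with the linear order $\prec_\sigma$: for $s\neq t$, with $j$ the first index where $s_j\neq t_j$ and $c=|\{i<j:\sigma_{s_i}=-\}|$, $s\prec_\sigma t$ iff ($c$ even and $s_j<t_j$) or ($c$ odd and $s_j>t_j$). The signed shift $\Sigma_\sigma$ deletes the first letter of a word. Let $\mathcal W_{k,n}$ be the set of words $(s_1\dots s_n)^\infty$ with $s_1\dots s_n$ primitive (not a power of a shorter word). For $s\in\mathcal W_{k,n}$ let $\Pi_\sigma(s)\in\mathcal S_n$ be the permutation with $\Pi_\sigma(s)_i<\Pi_\sigma(s)_j$ iff $s_is_{i+1}\dots\prec_\sigma s_js_{j+1}\dots$. Let $\mathcal P_n(\Sigma_\sigma)=\{\Pi_\sigma(s):s\in\mathcal W_{k,n}\}$ and $p_n(\Sigma_\sigma)=|\mathcal P_n(\Sigma_\sigma)|/n$ (the number of classes of $\mathcal P_n(\Sigma_\sigma)$ under cyclic rotation). $\Sigma_k$ denotes the $k$-shift $\Sigma_{+^k}$ (all signs $+$). $C(n,i)$ denotes the number of cyclic permutations ($n$-cycles) in $\mathcal S_n$ with exactly $i-1$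 descents, a descent of $\tau$ being an $i\in[n-1]$ with $\tau_i>\tau_{i+1}$. *)

theory Defs
  imports
    Complex_Main
    "HOL-Library.Stream"
    "HOL-Combinatorics.Permutations"
    "HOL-Combinatorics.Orbits"
    "HOL-Computational_Algebra.Squarefree"
begin

datatype plus_minus = Plus | Minus

text \<open>
  A signature of length \<open>k\<close> is a list of signs; the alphabet \<open>{0,\<dots>,k-1}\<close> is \<open>{..<length \<sigma>}\<close>.
  Stream positions start at 0, so the letter \<open>s\<^sub>i\<close> of the mathematical notation is \<open>s !! (i - 1)\<close>
  and the word \<open>s\<^sub>i s\<^sub>i\<^sub>+\<^sub>1 \<dots>\<close>, i.e. the shift applied \<open>i - 1\<close> times to \<open>s\<close>, is \<open>sdrop (i - 1) s\<close>.
\<close>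

definition infinite_words :: "nat \<Rightarrow> nat stream set" where
  "infinite_words k = streams {..<k}"

definition signed_less :: "plus_minus list \<Rightarrow> nat stream \<Rightarrow> nat stream \<Rightarrow> bool" where
  "signed_less \<sigma> s t \<longleftrightarrow>
     (\<exists>j. (\<forall>i<j. s !! i = t !! i) \<and> s !! j \<noteq> t !! j \<and>
        (let c = card {i. i < j \<and> \<sigma> ! (s !! i) = Minus}
         in (even c \<and> s !! j < t !! j) \<or> (odd c \<and> s !! j > t !! j)))"

definition primitive_word :: "'a list \<Rightarrow> bool" where
  "primitive_word w \<longleftrightarrow> \<not> (\<exists>u m. length u < length w \<and> w = concat (replicate m u))"

definition periodic_words :: "nat \<Rightarrow> nat \<Rightarrow> nat stream set" where
  "periodic_words k n =
     {s \<in> infinite_words k. \<exists>w. length w = n \<and> primitive_word w \<and> s = cycle w}"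

text \<open>
  Permutations in \<open>S\<^sub>n\<close> are functions on \<open>nat\<close> that permute \<open>{1..n}\<close> and are the identity elsewhere.
\<close>

definition pattern :: "plus_minus list \<Rightarrow> nat \<Rightarrow> nat stream \<Rightarrow> (nat \<Rightarrow> nat)" where
  "pattern \<sigma> n s =
     (THE \<pi>. \<pi> permutes {1..n} \<and>
        (\<forall>i\<in>{1..n}. \<forall>j\<in>{1..n}.
           \<pi> i < \<pi> j \<longleftrightarrow> signed_less \<sigma> (sdrop (i - 1) s) (sdrop (j - 1) s)))"

definition periodic_patterns :: "plus_minus list \<Rightarrow> nat \<Rightarrow> (nat \<Rightarrow> nat) set" where
  "periodic_patterns \<sigma> n = pattern \<sigma> n ` periodic_words (length \<sigma>) n"

definition num_periodic_patterns :: "plus_minus list \<Rightarrow> nat \<Rightarrow> real" where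
  "num_periodic_patterns \<sigma> n = real (card (periodic_patterns \<sigma> n)) / real n"

definition k_shift :: "nat \<Rightarrow> plus_minus list" where
  "k_shift k = replicate k Plus"

definition descents :: "nat \<Rightarrow> (nat \<Rightarrow> nat) \<Rightarrow> nat set" where
  "descents n \<tau> = {i \<in> {1..n - 1}. \<tau> i > \<tau> (i + 1)}"

definition num_cyclic_desc :: "nat \<Rightarrow> nat \<Rightarrow> nat" where
  "num_cyclic_desc n i =
     card {\<tau>. \<tau> permutes {1..n} \<and> cyclic_on \<tau> {1..n} \<and> card (descents n \<tau>) + 1 = i}"

definition moebius :: "nat \<Rightarrow> int" where
  "moebius d = (if squarefree d then (- 1) ^ card (prime_factors d) else 0)"

definition primitive_necklaces :: "nat \<Rightarrow> nat \<Rightarrow> real" where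
  "primitive_necklaces k n =
     1 / real n * (\<Sum>d | d dvd n. of_int (moebius d) * real k ^ (n div d))"

end

theory Submission
  imports Defs "HOL-Library.FuncSet"
begin

text \<open>
  Write \<open>\<pi>\<close> for the pattern of a periodic word \<open>s\<close> over \<open>k\<close> letters and \<open>\<tau>\<close> for the \<open>n\<close>-cycle
  \<open>(\<pi>\<^sub>1 \<pi>\<^sub>2 \<dots> \<pi>\<^sub>n)\<close>. Reading the letters of \<open>s\<close> by increasing rank gives a weakly increasing sequence
  that must increase strictly at every descent of \<open>\<tau>\<close>. Conversely, every such sequence comes from
  exactly one primitive word with pattern \<open>\<pi>\<close>: if two distinct shifts of the word agreed, then
  iterating the order-preserving shift around the cycle would make some rank smaller than itself.
  If \<open>\<tau>\<close> has \<open>i - 1\<close> descents, there are \<open>(n + k - i) choose n\<close> such sequences, a positive number iff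
  \<open>i \<le> k\<close>. Each \<open>n\<close>-cycle arises from \<open>n\<close> patterns, so \<open>p\<^sub>n(\<Sigma>\<^sub>k)\<close> counts the \<open>n\<close>-cycles with at most
  \<open>k - 1\<close> descents, and counting all primitive words, whose number is \<open>n L\<^sub>k(n)\<close> by Moebius inversion
  over the minimal period, gives the recurrence.
\<close>

section \<open>Counting primitive words\<close>

lemma prime_factors_Prod:
  fixes S :: "nat set"
  assumes "finite S" and "\<And>p. p \<in> S \<Longrightarrow> prime p"
  shows "prime_factors (\<Prod>S) = S"
proof -
  have "prime_factors (\<Prod>S) = \<Union>((prime_factors \<circ> (\<lambda>p. p)) ` S)"
    using assms by (intro prime_factors_prod) (auto dest: assms(2))
  also have "\<dots> = S"
    using assms by (auto simp: prime_factorization_prime)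
  finally show ?thesis .
qed

text \<open>Only squarefree divisors contribute, and these are the products of the subsets of the
  prime factors of \<open>N\<close>. The sum therefore expands the product of one factor
  \<open>1 - 1\<close> per prime, which is empty exactly for \<open>N = 1\<close>.\<close>

lemma sum_moebius_dvd:
  fixes N :: nat
  assumes "N > 0"
  shows "(\<Sum>d | d dvd N. moebius d) = (if N = 1 then 1 else 0)"
proof -
  let ?P = "prime_factors N"
  have prime: "prime p" if "p \<in> ?P" for p
    using that by auto
  have nz: "\<Prod>S \<noteq> 0" if "S \<subseteq> ?P" for S
    using that by (metis finite_subset finite_set_mset not_prime_0 prime prod_zero_iff subsetD)
  have dvd: "\<Prod>S dvd N" if "S \<subseteq> ?P" for S
  proof -
    have "\<Prod>S dvd \<Prod>?P"
      using that by (intro prod_dvd_prod_subset) auto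
    also have "\<dots> dvd (\<Prod>p\<in>?P. p ^ multiplicity p N)"
      by (intro prod_dvd_prod) (auto simp: prime_factors_multiplicity intro: dvd_power)
    also have "\<dots> = N"
      using assms by (simp add: prime_factorization_nat[symmetric])
    finally show ?thesis .
  qed
  have sqf: "squarefree (\<Prod>S)" if "S \<subseteq> ?P" for S
    using that prime by (intro squarefree_prod_coprime squarefree_prime) (auto intro!: primes_coprime)
  have "(\<Sum>d | d dvd N. moebius d) = (\<Sum>d | d dvd N \<and> squarefree d. (-1) ^ card (prime_factors d))"
    using assms by (intro sum.mono_neutral_cong_right) (auto simp: moebius_def)
  also have "\<dots> = (\<Sum>S\<in>Pow ?P. (-1) ^ card S)"
  proof (rule sum.reindex_bij_witness[of _ "\<lambda>S. \<Prod>S" prime_factors])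
    fix d assume d: "d \<in> {d. d dvd N \<and> squarefree d}"
    then have d0: "d > 0"
      using assms by (auto intro: Nat.gr0I)
    have "\<Prod>(prime_factors d) = (\<Prod>p\<in>prime_factors d. p ^ multiplicity p d)"
      using d d0 by (intro prod.cong) (auto simp: squarefree_factorial_semiring')
    then show "\<Prod>(prime_factors d) = d"
      using d0 by (simp add: prime_factorization_nat[symmetric])
    show "prime_factors d \<in> Pow ?P"
      using d assms by (simp add: dvd_prime_factors)
  next
    fix S assume S: "S \<in> Pow ?P"
    then show "prime_factors (\<Prod>S) = S"
      using prime by (intro prime_factors_Prod) (auto intro: finite_subset)
    show "\<Prod>S \<in> {d. d dvd N \<and> squarefree d}"
      using S dvd sqf by simp
  qed auto
  also have "\<dots> = (\<Prod>p\<in>?P. 1 - 1 :: int)"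
    by (subst prod_diff_conv_sum) auto
  also have "\<dots> = (if N = 1 then 1 else 0)"
  proof (cases "N = 1")
    case False
    then obtain p where "prime p" "p dvd N"
      by (metis prime_factor_nat)
    then have "p \<in> ?P"
      using assms by (simp add: prime_factors_dvd)
    then show ?thesis
      using False by (auto simp: card_gt_0_iff)
  qed auto
  finally show ?thesis .
qed

section \<open>Periods of streams and Moebius inversion over the least period\<close>

lemma sdrop_add_period: "sdrop b s = s \<Longrightarrow> sdrop (a + b) s = sdrop a s"
  by (metis add.commute sdrop_add)

lemma sdrop_mult_period: "sdrop m s = s \<Longrightarrow> sdrop (m * j) s = s"
  by (induction j) (simp_all add: sdrop_add_period add.commute)

lemma sdrop_mod_period: "sdrop n s = s \<Longrightarrow> sdrop (i mod n) s = sdrop i s"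
  by (metis mod_mult_div_eq add.commute sdrop_add sdrop_mult_period)

lemma snth_mod_period: "sdrop n s = s \<Longrightarrow> s !! (i mod n) = s !! i"
  by (metis sdrop_mod_period sdrop_simps(1))

text \<open>The remainder of a period modulo the least positive period is again a period, so
  minimality forces it to be 0.\<close>

lemma minimal_period_exists:
  assumes "sdrop n s = s" and "n > 0"
  obtains m where "m > 0" and "\<And>b. sdrop b s = s \<longleftrightarrow> m dvd b"
proof -
  define m where "m = (LEAST m. m > 0 \<and> sdrop m s = s)"
  have m: "m > 0 \<and> sdrop m s = s"
    unfolding m_def by (rule LeastI[of _ n]) (use assms in auto)
  have "m dvd b" if "sdrop b s = s" for b
  proof (rule ccontr)
    assume "\<not> m dvd b"
    then have "b mod m > 0"
      by (simp add: mod_greater_zero_iff_not_dvd)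
    moreover have "sdrop (b mod m) s = s"
      using that m by (simp add: sdrop_mod_period)
    ultimately have "m \<le> b mod m"
      unfolding m_def by (intro Least_le) auto
    then show False
      using m mod_less_divisor[of m b] by linarith
  qed
  then show ?thesis
    using that m by (metis dvdE sdrop_mult_period)
qed

lemma cycle_stake_period:
  assumes "sdrop n s = s" and "n > 0"
  shows "cycle (stake n s) = s"
proof -
  have ne: "stake n s \<noteq> []"
    using assms by simp
  have 1: "sdrop n (cycle (stake n s)) = cycle (stake n s)"
    using sdrop_cycle_eq[OF ne] by simp
  have 2: "stake n (cycle (stake n s)) = stake n s"
    using stake_cycle_eq[OF ne] by simp
  have "cycle (stake n s) !! i = s !! i" for i
  proof -
    have "i mod n < n"
      using assms by simp
    then have "cycle (stake n s) !! (i mod n) = s !! (i mod n)"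
      by (metis 2 stake_nth)
    then show ?thesis
      by (simp add: snth_mod_period[OF 1] snth_mod_period[OF assms(1)])
  qed
  \<comment> \<open>\<open>smap_alt\<close> at \<open>id\<close> acts as extensionality: streams
    that agree at every index are equal.\<close>
  then show ?thesis
    using smap_alt[of id "cycle (stake n s)" s] by (simp add: stream.map_id)
qed

text \<open>Primitivity is moved from the word to the stream. A period below \<open>n\<close> makes
  the least period a proper divisor of \<open>n\<close>, so the word is a power of a shorter prefix;
  conversely, a factorisation into copies of \<open>u\<close> gives the period
  \<open>length u\<close>.\<close>

lemma periodic_words_eq:
  assumes "n > 0"
  shows "periodic_words k n =
    {s \<in> streams {..<k}. sdrop n s = s \<and> (\<forall>d. 0 < d \<and> d < n \<longrightarrow> sdrop d s \<noteq> s)}"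
proof -
  have "(\<exists>w. length w = n \<and> primitive_word w \<and> s = cycle w) \<longleftrightarrow>
    sdrop n s = s \<and> (\<forall>d. 0 < d \<and> d < n \<longrightarrow> sdrop d s \<noteq> s)" (is "?L \<longleftrightarrow> ?R") for s :: "nat stream"
  proof
    assume ?L
    then obtain w where w: "length w = n" "primitive_word w" "s = cycle w"
      by blast
    then have ne: "w \<noteq> []"
      using assms by auto
    have per: "sdrop n s = s"
      using w ne by auto
    moreover have "sdrop d s \<noteq> s" if d: "0 < d" "d < n" for d
    proof
      assume "sdrop d s = s"
      obtain m where m: "m > 0" "\<And>b. sdrop b s = s \<longleftrightarrow> m dvd b"
        using minimal_period_exists[OF per assms] by blast
      have "m dvd d" "m dvd n"
        using m \<open>sdrop d s = s\<close> per by auto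
      then have "m < n"
        using d by (auto dest: dvd_imp_le)
      have "s = cycle (stake m s)"
        using m by (metis cycle_stake_period dvd_refl)
      then have "stake n s = concat (replicate (n div m) (stake m s))"
        using stake_cycle_eq_mod_0[of "stake m s" n] m \<open>m dvd n\<close> by (simp add: mod_eq_0_iff_dvd)
      moreover have "stake n s = w"
        using w ne by auto
      ultimately show False
        using w \<open>m < n\<close> by (metis length_stake primitive_word_def)
    qed
    ultimately show ?R
      by blast
  next
    assume R: ?R
    have "primitive_word (stake n s)"
      unfolding primitive_word_def
    proof
      assume "\<exists>u m. length u < length (stake n s) \<and> stake n s = concat (replicate m u)"
      then obtain u m where u: "length u < n" "stake n s = concat (replicate m u)"
        by auto
      have "u \<noteq> []"
        using u assms by (metis concat_replicate_trivial stake_invert_Nil less_not_refl)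
      have "n = m * length u"
        using arg_cong[OF u(2), of length] by (simp add: length_concat sum_list_replicate)
      then have "stake n (cycle u) = stake n s"
        using u stake_cycle_eq_mod_0[OF \<open>u \<noteq> []\<close>, of n] \<open>u \<noteq> []\<close> by simp
      moreover have "sdrop n (cycle u) = cycle u"
        using \<open>n = _\<close> \<open>u \<noteq> []\<close> by simp
      ultimately have "cycle u = s"
        using R assms by (metis cycle_stake_period)
      then have "sdrop (length u) s = s"
        using \<open>u \<noteq> []\<close> by auto
      then show False
        using R u \<open>u \<noteq> []\<close> by auto
    qed
    moreover have "s = cycle (stake n s)"
      using R assms by (simp add: cycle_stake_period)
    ultimately show ?L
      by (metis length_stake)
  qed
  then show ?thesis
    unfolding periodic_words_def infinite_words_def by simp
qed

text \<open>A stream with period \<open>n\<close> is determined by its first \<open>n\<close>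
  letters, and these may form any list over the alphabet.\<close>

lemma card_streams_period:
  assumes "n > 0"
  shows "finite {s \<in> streams {..<k}. sdrop n s = s}"
    and "card {s \<in> streams {..<k}. sdrop n s = s} = k ^ n"
proof -
  have "bij_betw cycle {w. set w \<subseteq> {..<k} \<and> length w = n} {s \<in> streams {..<k}. sdrop n s = s}"
  proof (rule bij_betw_byWitness[where f' = "stake n"])
    show "\<forall>w\<in>{w. set w \<subseteq> {..<k} \<and> length w = n}. stake n (cycle w) = w"
      using assms by (auto intro!: stake_cycle_eq)
    show "\<forall>s\<in>{s \<in> streams {..<k}. sdrop n s = s}. cycle (stake n s) = s"
      using assms by (auto intro: cycle_stake_period)
    show "cycle ` {w. set w \<subseteq> {..<k} \<and> length w = n} \<subseteq> {s \<in> streams {..<k}. sdrop n s = s}"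
      using assms by (auto simp: streams_iff_sset intro!: sdrop_cycle_eq)
    show "stake n ` {s \<in> streams {..<k}. sdrop n s = s} \<subseteq> {w. set w \<subseteq> {..<k} \<and> length w = n}"
      by (auto simp: streams_iff_sset sset_range set_conv_nth image_subset_iff)
  qed
  then show "finite {s \<in> streams {..<k}. sdrop n s = s}"
    and "card {s \<in> streams {..<k}. sdrop n s = s} = k ^ n"
    by (simp_all add: bij_betw_finite[symmetric] bij_betw_same_card[symmetric]
          finite_lists_length_eq card_lists_length_eq)
qed

text \<open>Double counting: in the Moebius sum a stream \<open>s\<close> of period \<open>n\<close>
  gets the weight \<open>moebius d\<close> for each \<open>d\<close> such that
  \<open>n div d\<close> is a period of \<open>s\<close>. If \<open>m\<close> is the least period,
  these \<open>d\<close> are the divisors of \<open>n div m\<close>, so the total weight is 1 for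
  \<open>m = n\<close> and 0 otherwise.\<close>

lemma card_periodic_words:
  assumes "n > 0"
  shows "real (card (periodic_words k n)) = real n * primitive_necklaces k n"
proof -
  let ?A = "\<lambda>d. {s \<in> streams {..<k}. sdrop d s = s}"
  have fin: "finite (?A n)"
    by (rule card_streams_period[OF assms])
  have inner: "(\<Sum>d | d dvd n \<and> sdrop (n div d) s = s. moebius d) =
      (if s \<in> periodic_words k n then 1 else 0)" if s: "s \<in> ?A n" for s
  proof -
    obtain m where m: "m > 0" "\<And>b. sdrop b s = s \<longleftrightarrow> m dvd b"
      using minimal_period_exists[OF _ assms, of s] s by blast
    have mn: "m dvd n"
      using m s by auto
    have "{d. d dvd n \<and> sdrop (n div d) s = s} = {d. d dvd n div m}"
    proof -
      obtain q where q: "n = m * q"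
        using mn by blast
      have "d dvd n \<and> m dvd n div d \<longleftrightarrow> d dvd q" for d
      proof
        assume "d dvd n \<and> m dvd n div d"
        then obtain c e where "n = d * c" "n div d = m * e"
          by blast
        then have "m * q = m * (d * e)"
          using q assms by simp
        then show "d dvd q"
          using m by simp
      next
        assume "d dvd q"
        then obtain e where "q = d * e"
          by blast
        then show "d dvd n \<and> m dvd n div d"
          using q assms by simp
      qed
      then have "d dvd n \<and> m dvd n div d \<longleftrightarrow> d dvd n div m" for d
        using q m by simp
      then show ?thesis
        using m by simp
    qed
    moreover have "n div m > 0"
      using dvd_imp_le[OF mn assms] m by (simp add: div_greater_zero_iff)
    moreover have "s \<in> periodic_words k n \<longleftrightarrow> n div m = 1"
    proof -
      have "n div m = 1 \<longleftrightarrow> m = n"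
        using dvd_mult_div_cancel[OF mn] m by auto
      moreover have "(\<forall>d. 0 < d \<and> d < n \<longrightarrow> \<not> m dvd d) \<longleftrightarrow> m = n"
      proof
        assume "\<forall>d. 0 < d \<and> d < n \<longrightarrow> \<not> m dvd d"
        then have "\<not> m < n"
          using m by auto
        then show "m = n"
          using dvd_imp_le[OF mn assms] by simp
      qed (auto dest: dvd_imp_le)
      ultimately show ?thesis
        using s m assms by (auto simp: periodic_words_eq)
    qed
    ultimately show ?thesis
      using sum_moebius_dvd[of "n div m"] by simp
  qed
  have sub: "?A (n div d) \<subseteq> ?A n" if "d dvd n" for d
    using sdrop_mult_period[of "n div d" _ d] that by auto
  \<comment> \<open>Each power counts the streams of period \<open>n div d\<close>, all of which lie
    in \<open>?A n\<close>; this prepares the exchange of the two sums.\<close>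
  have "(\<Sum>d | d dvd n. moebius d * int k ^ (n div d)) =
      (\<Sum>d | d dvd n. \<Sum>s | s \<in> ?A n \<and> sdrop (n div d) s = s. moebius d)"
  proof (rule sum.cong[OF refl])
    fix d assume d: "d \<in> {d. d dvd n}"
    then have "n div d > 0"
      using assms by auto
    then have "card (?A (n div d)) = k ^ (n div d)"
      by (rule card_streams_period)
    moreover have "{s. s \<in> ?A n \<and> sdrop (n div d) s = s} = ?A (n div d)"
      using sub d by auto
    ultimately show "moebius d * int k ^ (n div d) =
        (\<Sum>s | s \<in> ?A n \<and> sdrop (n div d) s = s. moebius d)"
      by simp
  qed
  also have "\<dots> = (\<Sum>s\<in>?A n. \<Sum>d | d \<in> {d. d dvd n} \<and> sdrop (n div d) s = s. moebius d)"
    using sum.swap_restrict[of "{d. d dvd n}" "?A n" "\<lambda>d s. moebius d" "\<lambda>d s. sdrop (n div d) s = s"]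
      fin assms by simp
  also have "\<dots> = (\<Sum>s\<in>?A n. if s \<in> periodic_words k n then 1 else 0)"
    using inner by (intro sum.cong) auto
  also have "\<dots> = int (card (periodic_words k n))"
    using fin assms by (subst sum.inter_filter[symmetric])
      (auto simp: periodic_words_eq intro!: arg_cong[of _ _ card])
  finally have "real_of_int (\<Sum>d | d dvd n. moebius d * int k ^ (n div d)) = card (periodic_words k n)"
    by simp
  then show ?thesis
    using assms by (simp add: primitive_necklaces_def)
qed

section \<open>Weakly increasing sequences with prescribed strict steps\<close>

text \<open>A strictly increasing list is determined by its set of entries, which may be any
  \<open>n\<close>-element subset of \<open>{..<M}\<close>.\<close>

lemma card_strict_sorted_lists:
  "card {ys :: nat list. length ys = n \<and> sorted_wrt (<) ys \<and> set ys \<subseteq> {..<M}} = M choose n"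
proof -
  have "bij_betw set {ys :: nat list. length ys = n \<and> sorted_wrt (<) ys \<and> set ys \<subseteq> {..<M}}
      {A. A \<subseteq> {..<M} \<and> card A = n}"
  proof (rule bij_betw_byWitness[where f' = sorted_list_of_set])
    show "\<forall>ys\<in>{ys :: nat list. length ys = n \<and> sorted_wrt (<) ys \<and> set ys \<subseteq> {..<M}}.
        sorted_list_of_set (set ys) = ys"
      by (auto intro: strict_sorted_equal)
    show "\<forall>A\<in>{A. A \<subseteq> {..<M} \<and> card A = n}. set (sorted_list_of_set A) = A"
      by (auto dest: finite_subset)
    show "set ` {ys :: nat list. length ys = n \<and> sorted_wrt (<) ys \<and> set ys \<subseteq> {..<M}}
        \<subseteq> {A. A \<subseteq> {..<M} \<and> card A = n}"
      by (auto simp: strict_sorted_iff distinct_card)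
    show "sorted_list_of_set ` {A. A \<subseteq> {..<M} \<and> card A = n}
        \<subseteq> {ys :: nat list. length ys = n \<and> sorted_wrt (<) ys \<and> set ys \<subseteq> {..<M}}"
    proof
      fix ys assume "ys \<in> sorted_list_of_set ` {A. A \<subseteq> {..<M} \<and> card A = n}"
      then obtain A where A: "ys = sorted_list_of_set A" "A \<subseteq> {..<M}" "card A = n"
        by blast
      then have "finite A"
        by (auto dest: finite_subset)
      then show "ys \<in> {ys. length ys = n \<and> sorted_wrt (<) ys \<and> set ys \<subseteq> {..<M}}"
        using A by simp
    qed
  qed
  then show ?thesis
    by (simp add: bij_betw_same_card n_subsets)
qed

text \<open>The maps are extensional, so that each is fixed by its values on \<open>{1..n}\<close>
  and the set can be counted.\<close>

definition weakly_increasing_maps :: "nat \<Rightarrow> nat \<Rightarrow> nat set \<Rightarrow> (nat \<Rightarrow> nat) set" where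
  "weakly_increasing_maps k n D = {a \<in> {1..n} \<rightarrow>\<^sub>E {..<k}.
     \<forall>x\<in>{1..<n}. a x \<le> a (Suc x) \<and> (x \<in> D \<longrightarrow> a x < a (Suc x))}"

text \<open>Adding to each value the number of preceding non-strict positions makes the sequence
  strictly increasing, and every strictly increasing sequence arises in this way.\<close>

lemma card_weakly_increasing_maps:
  assumes "n > 0" and "D \<subseteq> {1..<n}"
  shows "card (weakly_increasing_maps k n D) = (n + k - 1 - card D) choose n"
proof -
  define e where "e x = card ({1..<x} - D)" for x
  have e1: "e (Suc x) = (if x \<in> D then e x else Suc (e x))" if "x \<ge> 1" for x
  proof -
    have "{1..<Suc x} = insert x {1..<x}"
      using that by auto
    then show ?thesis
      by (simp add: e_def insert_Diff_if)
  qed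
  have e_le: "e x \<le> x - 1" for x
    unfolding e_def using card_mono[of "{1..<x}" "{1..<x} - D"] by simp
  \<comment> \<open>The largest shift is \<open>e n = n - 1 - card D\<close>, so the shifted values
    lie below \<open>k + e n\<close>.\<close>
  define M where "M = k + e n"
  have M: "M = n + k - 1 - card D"
    using assms card_mono[OF _ assms(2)] finite_subset[OF assms(2)]
    by (simp add: M_def e_def card_Diff_subset)
  let ?Y = "{ys :: nat list. length ys = n \<and> sorted_wrt (<) ys \<and> set ys \<subseteq> {..<M}}"
  \<comment> \<open>Lists are indexed from 0 and maps from 1, hence \<open>Suc i\<close> here and
    \<open>x - 1\<close> in the inverse \<open>?g\<close>.\<close>
  let ?f = "\<lambda>a. map (\<lambda>i. a (Suc i) + e (Suc i)) [0..<n]"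
  let ?g = "\<lambda>ys. \<lambda>x\<in>{1..n}. ys ! (x - 1) - e x"
  \<comment> \<open>Together with \<open>e_le\<close> this ensures that the natural subtraction in
    \<open>?g\<close> does not truncate.\<close>
  have nth_ge: "i \<le> ys ! i" if "ys \<in> ?Y" "i < n" for ys i
    using that(2)
  proof (induction i)
    case (Suc i)
    then have "ys ! i < ys ! Suc i"
      using that(1) by (auto simp: sorted_wrt_iff_nth_less)
    then show ?case
      using Suc by simp
  qed simp
  \<comment> \<open>The \<open>n - 1 - i\<close> later entries are larger and still below
    \<open>M\<close>. Combined with \<open>e_diff\<close>, this bounds the values of
    \<open>?g ys\<close> by \<open>k\<close>.\<close>
  have nth_le: "ys ! i + (n - 1 - i) < M" if "ys \<in> ?Y" "i < n" for ys i
    using that(2)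
  proof (induction "n - 1 - i" arbitrary: i)
    case 0
    then have "ys ! i \<in> set ys"
      using that(1) by auto
    then have "ys ! i < M"
      using that(1) by auto
    then show ?case
      using 0 by simp
  next
    case (Suc d)
    then have "ys ! i < ys ! Suc i"
      using that(1) by (auto simp: sorted_wrt_iff_nth_less)
    moreover have "ys ! Suc i + (n - 1 - Suc i) < M"
      using Suc by (intro Suc.hyps) auto
    ultimately show ?case
      using Suc.hyps(2) by linarith
  qed
  have e_diff: "e n \<le> e x + (n - x)" if "x \<in> {1..n}" for x
  proof -
    have "{1..<n} - D \<subseteq> ({1..<x} - D) \<union> {x..<n}"
      by auto
    then have "e n \<le> card (({1..<x} - D) \<union> {x..<n})"
      unfolding e_def by (intro card_mono) auto
    also have "\<dots> \<le> e x + (n - x)"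
      unfolding e_def using card_Un_le[of "{1..<x} - D" "{x..<n}"] by simp
    finally show ?thesis .
  qed
  have "bij_betw ?f (weakly_increasing_maps k n D) ?Y"
  proof (rule bij_betw_byWitness[where f' = ?g])
    show "\<forall>a\<in>weakly_increasing_maps k n D. ?g (?f a) = a"
    proof
      fix a assume "a \<in> weakly_increasing_maps k n D"
      then have "a \<in> extensional {1..n}"
        by (simp add: weakly_increasing_maps_def PiE_def)
      then show "?g (?f a) = a"
        by (intro extensionalityI[of _ "{1..n}"]) auto
    qed
    show "\<forall>ys\<in>?Y. ?f (?g ys) = ys"
    proof
      fix ys assume ys: "ys \<in> ?Y"
      show "?f (?g ys) = ys"
      proof (rule nth_equalityI)
        fix i assume "i < length (?f (?g ys))"
        then have "i < n"
          by simp
        then have "e (Suc i) \<le> ys ! i"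
          using nth_ge[OF ys, of i] e_le[of "Suc i"] by simp
        then show "?f (?g ys) ! i = ys ! i"
          using \<open>i < n\<close> by simp
      qed (use ys in auto)
    qed
    show "?f ` weakly_increasing_maps k n D \<subseteq> ?Y"
    proof
      fix ys assume "ys \<in> ?f ` weakly_increasing_maps k n D"
      then obtain a where a: "a \<in> weakly_increasing_maps k n D" and ys: "ys = ?f a"
        by blast
      have "\<forall>i. Suc i < n \<longrightarrow> a (Suc i) + e (Suc i) < a (Suc (Suc i)) + e (Suc (Suc i))"
        using a by (auto simp: weakly_increasing_maps_def e1 le_imp_less_Suc)
      then have "sorted_wrt (<) ys"
        unfolding ys by (subst sorted_wrt_iff_nth_Suc_transp) auto
      moreover have "set ys \<subseteq> {..<M}"
      proof -
        have "a (Suc i) + e (Suc i) < k + e n" if "i < n" for i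
        proof -
          have "a (Suc i) < k"
            using a that by (auto simp: weakly_increasing_maps_def)
          moreover have "e (Suc i) \<le> e n"
            unfolding e_def using that by (intro card_mono) auto
          ultimately show ?thesis
            by simp
        qed
        then show ?thesis
          by (auto simp: ys M_def)
      qed
      ultimately show "ys \<in> ?Y"
        by (simp add: ys)
    qed
    show "?g ` ?Y \<subseteq> weakly_increasing_maps k n D"
    proof
      fix a assume "a \<in> ?g ` ?Y"
      then obtain ys where ys: "ys \<in> ?Y" and a: "a = ?g ys"
        by blast
      have "a \<in> extensional {1..n}"
        by (simp add: a)
      have "a x \<in> {..<k}" if "x \<in> {1..n}" for x
      proof -
        have "ys ! (x - 1) + (n - 1 - (x - 1)) < M"
          using that by (intro nth_le[OF ys]) auto
        moreover have "a x = ys ! (x - 1) - e x"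
          using that by (simp add: a)
        moreover have "x - 1 \<le> ys ! (x - 1)"
          using that by (intro nth_ge[OF ys]) auto
        ultimately have "a x < k"
          using that e_diff[OF that] e_le[of x] unfolding M_def atLeastAtMost_iff by linarith
        then show ?thesis
          by simp
      qed
      moreover have "a x \<le> a (Suc x) \<and> (x \<in> D \<longrightarrow> a x < a (Suc x))" if x: "x \<in> {1..<n}" for x
      proof -
        have "ys ! (x - 1) < ys ! x"
          using ys x by (auto simp: sorted_wrt_iff_nth_less)
        moreover have "e x \<le> ys ! (x - 1)"
          using x by (intro order.trans[OF e_le nth_ge[OF ys]]) auto
        moreover have "a x = ys ! (x - 1) - e x" "a (Suc x) = ys ! x - e (Suc x)"
          using x by (simp_all add: a)
        ultimately show ?thesis
          using e1[of x] x by (auto split: if_splits)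
      qed
      ultimately show "a \<in> weakly_increasing_maps k n D"
        using \<open>a \<in> extensional {1..n}\<close> by (auto simp: weakly_increasing_maps_def PiE_def)
    qed
  qed
  then show ?thesis
    by (simp add: bij_betw_same_card card_strict_sorted_lists M)
qed

section \<open>Patterns of periodic words\<close>

definition lex_less :: "nat stream \<Rightarrow> nat stream \<Rightarrow> bool" where
  "lex_less s t \<longleftrightarrow> (\<exists>j. (\<forall>i<j. s !! i = t !! i) \<and> s !! j < t !! j)"

text \<open>Every letter of \<open>s\<close> indexes a \<open>Plus\<close>, so the set counted by
  \<open>c\<close> is empty and only the even case remains.\<close>

lemma signed_less_k_shift:
  assumes "s \<in> streams {..<k}"
  shows "signed_less (k_shift k) s t \<longleftrightarrow> lex_less s t"
proof -
  have "s !! i < k" for i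
    using assms by (auto simp: streams_iff_sset sset_range image_subset_iff)
  then have "k_shift k ! (s !! i) \<noteq> Minus" for i
    by (simp add: k_shift_def)
  then show ?thesis
    by (auto simp: signed_less_def lex_less_def Let_def)
qed

lemma lex_less_irrefl: "\<not> lex_less s s"
  by (simp add: lex_less_def)

lemma lex_less_trans:
  assumes "lex_less s t" and "lex_less t u"
  shows "lex_less s u"
proof -
  obtain i j where i: "\<forall>l<i. s !! l = t !! l" "s !! i < t !! i"
    and j: "\<forall>l<j. t !! l = u !! l" "t !! j < u !! j"
    using assms by (auto simp: lex_less_def)
  \<comment> \<open>The first difference of \<open>s\<close> and \<open>u\<close> sits at the
    smaller of the two indices.\<close>
  then have "s !! min i j < u !! min i j"
    by (cases i j rule: linorder_cases) (auto simp: min_def)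
  then show ?thesis
    unfolding lex_less_def using i j by (intro exI[of _ "min i j"]) auto
qed

lemma lex_less_asym: "lex_less s t \<Longrightarrow> \<not> lex_less t s"
  using lex_less_trans lex_less_irrefl by blast

lemma lex_less_linear:
  assumes "s \<noteq> t"
  shows "lex_less s t \<or> lex_less t s"
proof -
  have "\<exists>i. s !! i \<noteq> t !! i"
    using assms smap_alt[of id s t] by (auto simp: stream.map_id)
  define j where "j = (LEAST i. s !! i \<noteq> t !! i)"
  have "s !! j \<noteq> t !! j"
    unfolding j_def by (rule LeastI_ex) fact
  moreover have "\<forall>i<j. s !! i = t !! i"
    unfolding j_def by (auto dest: not_less_Least)
  ultimately show ?thesis
    unfolding lex_less_def by (metis linorder_neq_iff)
qed

lemma lex_less_sdrop_imp_le: "lex_less (sdrop i s) (sdrop j t) \<Longrightarrow> s !! i \<le> t !! j"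
  unfolding lex_less_def sdrop_snth by (metis add.right_neutral gr0I le_eq_less_or_eq)

text \<open>With equal first letters the first difference has a positive index, so it survives the
  deletion of that letter. This is the order preservation of the shift on which the descent
  condition rests.\<close>

lemma lex_less_sdrop_Suc:
  assumes "lex_less (sdrop i s) (sdrop j t)" and "s !! i = t !! j"
  shows "lex_less (sdrop (Suc i) s) (sdrop (Suc j) t)"
proof -
  obtain l where l: "\<forall>m<l. s !! (i + m) = t !! (j + m)" "s !! (i + l) < t !! (j + l)"
    using assms by (auto simp: lex_less_def sdrop_snth)
  then obtain l' where "l = Suc l'"
    using assms(2) by (cases l) auto
  then show ?thesis
    using l unfolding lex_less_def sdrop_snth by (intro exI[of _ l']) auto
qed

section \<open>Ranks of the shifts and the cycle they form\<close>

text \<open>For a pattern \<open>\<pi>\<close> this is the rank of the stream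
  \<open>sdrop i s\<close>, for any \<open>i\<close>: the index is reduced modulo \<open>n\<close>
  and moved from positions starting at 0 to arguments starting at 1.\<close>

definition cyclic_rank :: "nat \<Rightarrow> (nat \<Rightarrow> nat) \<Rightarrow> nat \<Rightarrow> nat" where
  "cyclic_rank n \<pi> i = \<pi> (Suc (i mod n))"

text \<open>In cycle notation this is \<open>(\<pi>\<^sub>1 \<pi>\<^sub>2 \<dots> \<pi>\<^sub>n)\<close>.\<close>

definition rank_cycle :: "nat \<Rightarrow> (nat \<Rightarrow> nat) \<Rightarrow> nat \<Rightarrow> nat" where
  "rank_cycle n \<pi> x = (if x \<in> {1..n} then cyclic_rank n \<pi> (inv \<pi> x) else x)"

lemma cyclic_rank_add_mult [simp]: "cyclic_rank n \<pi> (i + n * j) = cyclic_rank n \<pi> i"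
  by (simp add: cyclic_rank_def)

context
  fixes n :: nat and \<pi> :: "nat \<Rightarrow> nat"
  assumes n: "n > 0" and perm: "\<pi> permutes {1..n}"
begin

lemma cyclic_rank_in: "cyclic_rank n \<pi> i \<in> {1..n}"
  using n permutes_in_image[OF perm, of "Suc (i mod n)"] mod_less_divisor[of n i]
  unfolding cyclic_rank_def by (simp add: Suc_le_eq)

lemma cyclic_rank_eq_iff: "cyclic_rank n \<pi> i = cyclic_rank n \<pi> j \<longleftrightarrow> i mod n = j mod n"
  using permutes_inj[OF perm] by (auto simp: cyclic_rank_def inj_eq)

lemma cyclic_rank_surj:
  assumes "x \<in> {1..n}"
  obtains i where "i < n" and "x = cyclic_rank n \<pi> i"
proof
  have "inv \<pi> x \<in> {1..n}"
    using assms permutes_in_image[OF permutes_inv[OF perm]] by blast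
  then show "inv \<pi> x - 1 < n" and "x = cyclic_rank n \<pi> (inv \<pi> x - 1)"
    using permutes_inverses(1)[OF perm, of x] by (auto simp: cyclic_rank_def)
qed

text \<open>Hence \<open>rank_cycle\<close> is the action of the shift on ranks, which lets
  comparisons of shifted words be read off as ascents and descents.\<close>

lemma rank_cycle_cyclic_rank: "rank_cycle n \<pi> (cyclic_rank n \<pi> i) = cyclic_rank n \<pi> (Suc i)"
  using cyclic_rank_in[of i] permutes_inverses(2)[OF perm, of "Suc (i mod n)"]
  by (simp add: rank_cycle_def cyclic_rank_def mod_Suc_eq)

lemma rank_cycle_inj_on: "inj_on (rank_cycle n \<pi>) {1..n}"
proof (rule inj_onI)
  fix x y assume xy: "x \<in> {1..n}" "y \<in> {1..n}" "rank_cycle n \<pi> x = rank_cycle n \<pi> y"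
  obtain i where i: "i < n" "x = cyclic_rank n \<pi> i"
    using cyclic_rank_surj[OF xy(1)] .
  obtain j where j: "j < n" "y = cyclic_rank n \<pi> j"
    using cyclic_rank_surj[OF xy(2)] .
  have "Suc i mod n = Suc j mod n"
    using xy(3) by (simp add: i j rank_cycle_cyclic_rank cyclic_rank_eq_iff)
  then have "i = j"
    using i(1) j(1) by (auto simp: mod_Suc split: if_splits)
  then show "x = y"
    by (simp add: i j)
qed

end

section \<open>Existence and uniqueness of the pattern\<close>

text \<open>A relational form of \<open>pattern\<close> without \<open>THE\<close>, with the
  comparison stated for all indices instead of \<open>{1..n}\<close>.\<close>

definition pattern_of :: "nat \<Rightarrow> nat stream \<Rightarrow> (nat \<Rightarrow> nat) \<Rightarrow> bool" where
  "pattern_of n s \<pi> \<longleftrightarrow> \<pi> permutes {1..n} \<and>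
     (\<forall>i j. cyclic_rank n \<pi> i < cyclic_rank n \<pi> j \<longleftrightarrow> lex_less (sdrop i s) (sdrop j s))"

text \<open>The values up to \<open>\<pi> i\<close> are exactly \<open>1, ..., \<pi> i\<close>. So a
  permutation can be recovered from its comparisons, which yields uniqueness of the pattern.\<close>

lemma permutes_eq_card_le:
  assumes "\<pi> permutes {1..n}" and "i \<in> {1..n}"
  shows "\<pi> i = card {j \<in> {1..n}. \<pi> j \<le> \<pi> i}"
proof -
  have im: "\<pi> ` {1..n} = {1..n}"
    using assms permutes_image by blast
  have "\<pi> ` {j \<in> {1..n}. \<pi> j \<le> \<pi> i} = {1..\<pi> i}"
  proof -
    have "\<pi> i \<le> n"
      using im assms(2) by (metis atLeastAtMost_iff imageI)
    have "\<pi> ` {j \<in> {1..n}. \<pi> j \<le> \<pi> i} = \<pi> ` {1..n} \<inter> {..\<pi> i}"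
      by auto
    also have "\<dots> = {1..\<pi> i}"
      using im \<open>\<pi> i \<le> n\<close> by auto
    finally show ?thesis .
  qed
  moreover have "card (\<pi> ` {j \<in> {1..n}. \<pi> j \<le> \<pi> i}) = card {j \<in> {1..n}. \<pi> j \<le> \<pi> i}"
    using permutes_inj_on[OF assms(1)] by (rule card_image)
  ultimately show ?thesis
    by simp
qed

lemma pattern_of_unique:
  assumes "n > 0" and "pattern_of n s \<pi>" and "pattern_of n s \<rho>"
  shows "\<pi> = \<rho>"
proof -
  have perm: "\<pi> permutes {1..n}" "\<rho> permutes {1..n}"
    using assms by (auto simp: pattern_of_def)
  have less: "\<pi> i < \<pi> j \<longleftrightarrow> \<rho> i < \<rho> j" if "i \<in> {1..n}" "j \<in> {1..n}" for i j
  proof -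
    have "\<pi> i = cyclic_rank n \<pi> (i - 1)" "\<pi> j = cyclic_rank n \<pi> (j - 1)"
      "\<rho> i = cyclic_rank n \<rho> (i - 1)" "\<rho> j = cyclic_rank n \<rho> (j - 1)"
      using that by (auto simp: cyclic_rank_def)
    then show ?thesis
      using assms by (simp add: pattern_of_def)
  qed
  have "\<pi> i = \<rho> i" if "i \<in> {1..n}" for i
  proof -
    have "{j \<in> {1..n}. \<pi> j \<le> \<pi> i} = {j \<in> {1..n}. \<rho> j \<le> \<rho> i}"
      using less that by (auto simp flip: not_less)
    then show ?thesis
      using permutes_eq_card_le[OF perm(1) that] permutes_eq_card_le[OF perm(2) that] by simp
  qed
  then show ?thesis
    using perm by (metis ext permutes_not_in)
qed

text \<open>If the shifts by \<open>i < j < n\<close> agreed, shifting both by \<open>n - j\<close>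
  more would give the period \<open>i + (n - j)\<close>, strictly between 0 and
  \<open>n\<close>.\<close>

lemma sdrop_eq_iff_primitive:
  assumes "n > 0" and s: "s \<in> periodic_words k n"
  shows "sdrop i s = sdrop j s \<longleftrightarrow> i mod n = j mod n"
proof -
  have per: "sdrop n s = s" and prim: "\<And>d. 0 < d \<Longrightarrow> d < n \<Longrightarrow> sdrop d s \<noteq> s"
    using assms by (auto simp: periodic_words_eq)
  have aux: "i \<ge> j" if "i < n" "j < n" "sdrop i s = sdrop j s" for i j
  proof (rule ccontr)
    assume "\<not> i \<ge> j"
    have "sdrop (i + (n - j)) s = sdrop (j + (n - j)) s"
      using that(3) by (metis sdrop_add)
    then have "sdrop (i + (n - j)) s = s"
      using that per by simp
    then show False
      using prim[of "i + (n - j)"] \<open>\<not> i \<ge> j\<close> that by linarith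
  qed
  show ?thesis
    using aux[of "i mod n" "j mod n"] aux[of "j mod n" "i mod n"] assms(1)
    by (metis le_antisym mod_less_divisor per sdrop_mod_period)
qed

text \<open>The rank of a shift is one more than the number of smaller ones among the first
  \<open>n\<close>. Since these are pairwise distinct and linearly ordered, the ranks form a
  permutation.\<close>

lemma pattern_of_exists:
  assumes "n > 0" and s: "s \<in> periodic_words k n"
  shows "\<exists>\<pi>. pattern_of n s \<pi>"
proof -
  have per: "sdrop n s = s"
    using assms by (auto simp: periodic_words_eq)
  note eq = sdrop_eq_iff_primitive[OF assms]
  define r where "r i = Suc (card {j. j < n \<and> lex_less (sdrop j s) (sdrop i s)})" for i
  define \<pi> where "\<pi> x = (if x \<in> {1..n} then r (x - 1) else x)" for x
  have r_less: "r i < r j" if "lex_less (sdrop i s) (sdrop j s)" for i j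
  proof -
    \<comment> \<open>\<open>i mod n\<close> is counted for \<open>j\<close> but not for
      \<open>i\<close>, which makes the inclusion of the counted sets strict.\<close>
    have "i mod n \<in> {l. l < n \<and> lex_less (sdrop l s) (sdrop j s)}"
      using that assms(1) by (simp add: sdrop_mod_period[OF per])
    moreover have "i mod n \<notin> {l. l < n \<and> lex_less (sdrop l s) (sdrop i s)}"
      by (simp add: sdrop_mod_period[OF per] lex_less_irrefl)
    moreover have "{l. l < n \<and> lex_less (sdrop l s) (sdrop i s)}
        \<subseteq> {l. l < n \<and> lex_less (sdrop l s) (sdrop j s)}"
      using that lex_less_trans by blast
    ultimately have "{l. l < n \<and> lex_less (sdrop l s) (sdrop i s)}
        \<subset> {l. l < n \<and> lex_less (sdrop l s) (sdrop j s)}"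
      by blast
    then show ?thesis
      unfolding r_def by (simp add: psubset_card_mono)
  qed
  have r_eq: "r i = r j \<longleftrightarrow> i mod n = j mod n" for i j
  proof
    assume "r i = r j"
    then show "i mod n = j mod n"
      using r_less lex_less_linear eq by (metis less_irrefl)
  next
    assume "i mod n = j mod n"
    then have "sdrop i s = sdrop j s"
      by (simp add: eq)
    then show "r i = r j"
      by (simp add: r_def)
  qed
  have r_iff: "r i < r j \<longleftrightarrow> lex_less (sdrop i s) (sdrop j s)" for i j
    using r_less r_eq eq lex_less_linear by (metis less_asym less_irrefl)
  have r_le: "r i \<in> {1..n}" for i
  proof -
    have "{j. j < n \<and> lex_less (sdrop j s) (sdrop i s)} \<subseteq> {..<n} - {i mod n}"
      by (auto simp: sdrop_mod_period[OF per] lex_less_irrefl)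
    then have "card {j. j < n \<and> lex_less (sdrop j s) (sdrop i s)} \<le> card ({..<n} - {i mod n})"
      by (intro card_mono) auto
    then show ?thesis
      using assms(1) by (simp add: r_def)
  qed
  have "inj_on \<pi> {1..n}"
  proof (rule inj_onI)
    fix x y assume "x \<in> {1..n}" "y \<in> {1..n}" "\<pi> x = \<pi> y"
    then have "(x - 1) mod n = (y - 1) mod n"
      by (simp add: \<pi>_def r_eq)
    then show "x = y"
      using \<open>x \<in> {1..n}\<close> \<open>y \<in> {1..n}\<close> by auto
  qed
  moreover have "\<pi> ` {1..n} \<subseteq> {1..n}"
    using r_le by (auto simp: \<pi>_def)
  ultimately have "bij_betw \<pi> {1..n} {1..n}"
    by (simp add: bij_betw_def endo_inj_surj)
  then have "\<pi> permutes {1..n}"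
    by (rule bij_imp_permutes) (auto simp: \<pi>_def)
  moreover have "cyclic_rank n \<pi> i = r i" for i
  proof -
    have "cyclic_rank n \<pi> i = r (i mod n)"
      using assms(1) by (simp add: cyclic_rank_def \<pi>_def Suc_le_eq)
    also have "\<dots> = r i"
      by (simp add: r_eq)
    finally show ?thesis .
  qed
  ultimately show ?thesis
    unfolding pattern_of_def using r_iff by auto
qed

text \<open>Existence and uniqueness make the \<open>THE\<close> in \<open>pattern\<close> well
  defined; periodicity extends the comparisons from \<open>{1..n}\<close> to all indices.\<close>

lemma pattern_eq_iff:
  assumes "n > 0" and s: "s \<in> periodic_words k n"
  shows "pattern (k_shift k) n s = \<pi> \<longleftrightarrow> pattern_of n s \<pi>"
proof -
  have per: "sdrop n s = s" and str: "s \<in> streams {..<k}"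
    using assms by (auto simp: periodic_words_eq)
  have str': "sdrop i s \<in> streams {..<k}" for i
    using str by (induction i arbitrary: s) (auto simp: streams_stl)
  have "(\<rho> permutes {1..n} \<and> (\<forall>i\<in>{1..n}. \<forall>j\<in>{1..n}. \<rho> i < \<rho> j \<longleftrightarrow>
      signed_less (k_shift k) (sdrop (i - 1) s) (sdrop (j - 1) s))) \<longleftrightarrow> pattern_of n s \<rho>"
    (is "_ \<and> ?L \<longleftrightarrow> _") for \<rho>
  proof -
    have "?L \<longleftrightarrow> (\<forall>i j. cyclic_rank n \<rho> i < cyclic_rank n \<rho> j \<longleftrightarrow> lex_less (sdrop i s) (sdrop j s))"
      (is "_ \<longleftrightarrow> ?R")
    proof
      assume L: ?L
      show ?R
      proof (intro allI)
        fix i j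
        have "Suc (i mod n) \<in> {1..n}" "Suc (j mod n) \<in> {1..n}"
          using assms(1) by (auto simp: Suc_le_eq)
        then show "cyclic_rank n \<rho> i < cyclic_rank n \<rho> j \<longleftrightarrow> lex_less (sdrop i s) (sdrop j s)"
          using L by (auto simp: cyclic_rank_def signed_less_k_shift[OF str'] sdrop_mod_period[OF per])
      qed
    next
      assume R: ?R
      show ?L
      proof (intro ballI)
        fix i j assume "i \<in> {1..n}" "j \<in> {1..n}"
        then have "cyclic_rank n \<rho> (i - 1) = \<rho> i" "cyclic_rank n \<rho> (j - 1) = \<rho> j"
          by (auto simp: cyclic_rank_def)
        then show "\<rho> i < \<rho> j \<longleftrightarrow> signed_less (k_shift k) (sdrop (i - 1) s) (sdrop (j - 1) s)"
          using R by (metis signed_less_k_shift[OF str'])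
      qed
    qed
    then show ?thesis
      by (simp add: pattern_of_def)
  qed
  then have "pattern (k_shift k) n s = (THE \<rho>. pattern_of n s \<rho>)"
    unfolding pattern_def by simp
  moreover obtain \<rho> where "pattern_of n s \<rho>"
    using pattern_of_exists[OF assms] by blast
  moreover from this have "(THE \<rho>. pattern_of n s \<rho>) = \<rho>"
    using pattern_of_unique[OF assms(1)] by blast
  ultimately show ?thesis
    using pattern_of_unique[OF assms(1)] by metis
qed

section \<open>Words with a given pattern\<close>

lemma descents_subset: "descents n \<tau> \<subseteq> {1..<n}"
  by (auto simp: descents_def)

lemma weakly_increasing_maps_mono:
  assumes "a \<in> weakly_increasing_maps k n D" and "1 \<le> x" and "x \<le> y" and "y \<le> n"
  shows "a x \<le> a y"
  using assms(3,4)
proof (induction y rule: dec_induct)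
  case (step y)
  then have "a y \<le> a (Suc y)"
    using assms(1,2) by (auto simp: weakly_increasing_maps_def)
  then show ?case
    using step by simp
qed simp

text \<open>Equal values at the ends force \<open>a\<close> to be constant in between. A descent
  would require a strict step there, so \<open>\<tau>\<close> does not decrease from
  \<open>x\<close> to \<open>y\<close>.\<close>

lemma weakly_increasing_maps_eq_imp_le:
  fixes \<tau> :: "nat \<Rightarrow> nat"
  assumes a: "a \<in> weakly_increasing_maps k n (descents n \<tau>)"
    and "1 \<le> x" and "x \<le> y" and "y \<le> n" and "a x = a y"
  shows "\<tau> x \<le> \<tau> y"
  using assms(3-5)
proof (induction y rule: dec_induct)
  case (step y)
  have "a x \<le> a y" "a y \<le> a (Suc y)"
    by (rule weakly_increasing_maps_mono[OF a]; use step assms(2) in simp)+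
  then have "a x = a y" "a y = a (Suc y)"
    using step by auto
  then have "y \<notin> descents n \<tau>"
    using a step assms(2) by (auto simp: weakly_increasing_maps_def)
  then have "\<tau> y \<le> \<tau> (Suc y)"
    using step assms(2) by (auto simp: descents_def)
  then show ?case
    using step \<open>a x = a y\<close> by simp
qed simp

text \<open>The letter map of \<open>s\<close> sends a rank to the letter at the position of that rank. Two consecutive
  ranks with the same letter keep their order when the first letter is deleted, so the letter
  map increases strictly at the descents of the cycle.\<close>

lemma card_pattern_fibre:
  assumes n: "n > 0" and perm: "\<pi> permutes {1..n}"
  shows "card {s \<in> periodic_words k n. pattern_of n s \<pi>} =
    (n + k - 1 - card (descents n (rank_cycle n \<pi>))) choose n"
proof -
  let ?q = "cyclic_rank n \<pi>" and ?\<tau> = "rank_cycle n \<pi>"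
  let ?W = "weakly_increasing_maps k n (descents n ?\<tau>)"
  let ?F = "{s \<in> periodic_words k n. pattern_of n s \<pi>}"
  let ?word = "\<lambda>a. smap (\<lambda>i. a (?q i)) nats"
  let ?letter = "\<lambda>s. \<lambda>x\<in>{1..n}. s !! (inv \<pi> x - 1)"
  note q_in = cyclic_rank_in[OF n perm]
  note q_eq = cyclic_rank_eq_iff[OF n perm]
  note q_surj = cyclic_rank_surj[OF n perm]
  note tau_q = rank_cycle_cyclic_rank[OF n perm]
  have word_nth: "?word a !! i = a (?q i)" for a :: "nat \<Rightarrow> nat" and i
    by simp
  have letter_q: "?letter s (?q i) = s !! i" if "s \<in> ?F" for s i
  proof -
    have "inv \<pi> (?q i) = Suc (i mod n)"
      using permutes_inverses(2)[OF perm] by (simp add: cyclic_rank_def)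
    moreover have "s !! (i mod n) = s !! i"
      using that n by (intro snth_mod_period) (auto simp: periodic_words_eq)
    ultimately show ?thesis
      using q_in[of i] by simp
  qed
  \<comment> \<open>As long as the letters agree, the ranks keep their order along the cycle. At the
    first disagreement the smaller rank carries the smaller letter because \<open>a\<close> is
    weakly increasing.\<close>
  have word_less: "lex_less (sdrop i (?word a)) (sdrop j (?word a))"
    if a: "a \<in> ?W" and less: "?q i < ?q j" for a i j
  proof -
    have step: "?q (Suc i) < ?q (Suc j)" if "?q i < ?q j" "a (?q i) = a (?q j)" for i j
    proof -
      have "?\<tau> (?q i) \<le> ?\<tau> (?q j)"
        using that q_in[of i] q_in[of j] by (intro weakly_increasing_maps_eq_imp_le[OF a]) auto
      moreover have "?\<tau> (?q i) \<noteq> ?\<tau> (?q j)"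
        using that q_in[of i] q_in[of j] inj_onD[OF rank_cycle_inj_on[OF n perm], of "?q i" "?q j"]
        by auto
      ultimately show ?thesis
        by (simp add: tau_q)
    qed
    have run: "?q (i + m) < ?q (j + m)" if "\<forall>l<m. a (?q (i + l)) = a (?q (j + l))" for m
      using that
    proof (induction m)
      case (Suc m)
      then show ?case
        using step[of "i + m" "j + m"] by simp
    qed (simp add: less)
    \<comment> \<open>Without a disagreement there would be an increasing chain
      \<open>?q i < ?q (i + d) < ?q (i + 2 * d) < ...\<close> with \<open>d\<close> congruent to
      \<open>j - i\<close>, and this chain closes up modulo \<open>n\<close>.\<close>
    have "\<exists>m. a (?q (i + m)) \<noteq> a (?q (j + m))"
    proof (rule ccontr)
      assume "\<not> ?thesis"
      then have all: "?q (i + m) < ?q (j + m)" for m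
        using run by blast
      \<comment> \<open>The summand \<open>n * i\<close> vanishes modulo \<open>n\<close> and keeps
        the subtraction of \<open>i\<close> from truncating.\<close>
      define d where "d = j + n * i - i"
      have "1 * i \<le> n * i"
        using n by (intro mult_le_mono1) simp
      then have d: "i + d = j + n * i"
        unfolding d_def by linarith
      have less_d: "?q (i + m) < ?q (i + m + d)" for m
      proof -
        have "i + m + d = (j + m) + n * i"
          using d by simp
        then have "?q (i + m + d) = ?q (j + m)"
          by (metis cyclic_rank_add_mult)
        then show ?thesis
          using all by simp
      qed
      have "?q i < ?q (i + Suc l * d)" for l
      proof (induction l)
        case (Suc l)
        have "?q (i + Suc l * d) < ?q (i + Suc l * d + d)"
          by (rule less_d)
        also have "i + Suc l * d + d = i + Suc (Suc l) * d"
          by simp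
        finally show ?case
          using Suc by simp
      qed (use less_d[of 0] in simp)
      \<comment> \<open>\<open>n\<close> steps of length \<open>d\<close> advance the index by a
        multiple of \<open>n\<close>, giving \<open>?q i < ?q i\<close>.\<close>
      from this[of "n - 1"] show False
        using n by simp
    qed
    define m where "m = (LEAST m. a (?q (i + m)) \<noteq> a (?q (j + m)))"
    have ne: "a (?q (i + m)) \<noteq> a (?q (j + m))"
      unfolding m_def by (rule LeastI_ex) fact
    have eq: "\<forall>l<m. a (?q (i + l)) = a (?q (j + l))"
      unfolding m_def by (auto dest: not_less_Least)
    have "a (?q (i + m)) \<le> a (?q (j + m))"
      using run[OF eq] q_in[of "i + m"] q_in[of "j + m"]
      by (intro weakly_increasing_maps_mono[OF a]) auto
    with ne eq show ?thesis
      unfolding lex_less_def sdrop_snth word_nth by (intro exI[of _ m]) auto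
  qed
  have "bij_betw ?word ?W ?F"
  proof (rule bij_betw_byWitness[where f' = ?letter])
    show "\<forall>a\<in>?W. ?letter (?word a) = a"
    proof
      fix a assume "a \<in> ?W"
      then have "a \<in> extensional {1..n}"
        by (simp add: weakly_increasing_maps_def PiE_def)
      moreover have "?letter (?word a) x = a x" if x: "x \<in> {1..n}" for x
      proof -
        obtain i where i: "i < n" "x = ?q i"
          using q_surj[OF x] .
        then have "inv \<pi> x = Suc i"
          using permutes_inverses(2)[OF perm] by (simp add: cyclic_rank_def)
        then show ?thesis
          using x i by simp
      qed
      ultimately show "?letter (?word a) = a"
        by (intro extensionalityI[of _ "{1..n}"]) auto
    qed
    show "\<forall>s\<in>?F. ?word (?letter s) = s"
    proof
      fix s assume s: "s \<in> ?F"
      show "?word (?letter s) = s"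
        unfolding smap_alt using letter_q[OF s] by simp
    qed
    show "?word ` ?W \<subseteq> ?F"
    proof
      fix s assume "s \<in> ?word ` ?W"
      then obtain a where a: "a \<in> ?W" and s: "s = ?word a"
        by blast
      have less: "lex_less (sdrop i s) (sdrop j s)" if "?q i < ?q j" for i j
        using word_less[OF a that] by (simp add: s)
      have s_nth: "s !! i = a (?q i)" for i
        by (simp add: s)
      have "a (?q i) < k" for i
        using a q_in[of i] by (auto simp: weakly_increasing_maps_def PiE_def Pi_def)
      then have "s \<in> streams {..<k}"
        by (auto simp: streams_iff_sset sset_range s_nth)
      moreover have per: "sdrop n s = s"
      proof -
        have "sdrop n s !! i = s !! i" for i
          unfolding sdrop_snth s_nth using cyclic_rank_add_mult[of n \<pi> i 1] by (simp add: add.commute)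
        then show ?thesis
          using smap_alt[of id "sdrop n s" s] by (simp add: stream.map_id)
      qed
      \<comment> \<open>The ranks at indices 0 and \<open>d\<close> differ, so \<open>s\<close> and
        its shift by \<open>d\<close> are strictly comparable.\<close>
      moreover have "sdrop d s \<noteq> s" if "0 < d" "d < n" for d
      proof -
        have "?q 0 \<noteq> ?q d"
          using that by (simp add: q_eq)
        then show ?thesis
          using less[of 0 d] less[of d 0] lex_less_irrefl[of s]
          by (cases "?q 0" "?q d" rule: linorder_cases) auto
      qed
      moreover have "pattern_of n s \<pi>"
        unfolding pattern_of_def
      proof (intro conjI allI iffI)
        fix i j assume L: "lex_less (sdrop i s) (sdrop j s)"
        show "?q i < ?q j"
        proof (cases "?q i" "?q j" rule: linorder_cases)
          case equal
          then have "sdrop i s = sdrop j s"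
            by (metis q_eq per sdrop_mod_period)
          then show ?thesis
            using L lex_less_irrefl by auto
        next
          case greater
          then show ?thesis
            using L less lex_less_asym by blast
        qed
      qed (use perm less in auto)
      ultimately show "s \<in> ?F"
        using n by (auto simp: periodic_words_eq)
    qed
    show "?letter ` ?F \<subseteq> ?W"
    proof
      fix a assume "a \<in> ?letter ` ?F"
      then obtain s where s: "s \<in> ?F" and a: "a = ?letter s"
        by blast
      have str: "s \<in> streams {..<k}"
        using s n by (auto simp: periodic_words_eq)
      have "a \<in> {1..n} \<rightarrow>\<^sub>E {..<k}"
        unfolding a using str by (auto simp: streams_iff_sset sset_range image_subset_iff)
      moreover have "a x \<le> a (Suc x) \<and> (x \<in> descents n ?\<tau> \<longrightarrow> a x < a (Suc x))"
        if x: "x \<in> {1..<n}" for x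
      proof -
        obtain i where i: "x = ?q i"
          using q_surj[of x] x by auto
        obtain j where j: "Suc x = ?q j"
          using q_surj[of "Suc x"] x by auto
        have ai: "a x = s !! i"
          unfolding a i by (rule letter_q[OF s])
        have aj: "a (Suc x) = s !! j"
          unfolding a j by (rule letter_q[OF s])
        have "?q i < ?q j"
          unfolding i[symmetric] j[symmetric] by simp
        then have L: "lex_less (sdrop i s) (sdrop j s)"
          using s by (auto simp: pattern_of_def)
        have \<tau>i: "?\<tau> x = ?q (Suc i)"
          unfolding i by (rule tau_q)
        have \<tau>j: "?\<tau> (Suc x) = ?q (Suc j)"
          unfolding j by (rule tau_q)
        have "?\<tau> x < ?\<tau> (Suc x)" if "s !! i = s !! j"
          using lex_less_sdrop_Suc[OF L that] s by (auto simp: pattern_of_def \<tau>i \<tau>j)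
        then have "s !! i \<noteq> s !! j" if "x \<in> descents n ?\<tau>"
          using that by (auto simp: descents_def)
        then show ?thesis
          using lex_less_sdrop_imp_le[OF L] ai aj by auto
      qed
      ultimately show "a \<in> ?W"
        by (simp add: weakly_increasing_maps_def)
    qed
  qed
  then have "card ?F = card ?W"
    by (simp add: bij_betw_same_card)
  then show ?thesis
    using card_weakly_increasing_maps[OF n descents_subset] by simp
qed

section \<open>Summation over cyclic permutations\<close>

abbreviation perms :: "nat \<Rightarrow> (nat \<Rightarrow> nat) set" where
  "perms n \<equiv> {\<pi>. \<pi> permutes {1..n}}"

abbreviation cyclic_perms :: "nat \<Rightarrow> (nat \<Rightarrow> nat) set" where
  "cyclic_perms n \<equiv> {\<tau>. \<tau> permutes {1..n} \<and> cyclic_on \<tau> {1..n}}"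

section \<open>Permutations with a given rank cycle\<close>

lemma funpow_rank_cycle:
  assumes "n > 0" and "\<pi> permutes {1..n}"
  shows "(rank_cycle n \<pi> ^^ i) (\<pi> 1) = cyclic_rank n \<pi> i"
proof (induction i)
  case 0
  show ?case
    by (simp add: cyclic_rank_def)
next
  case (Suc i)
  then show ?case
    by (simp add: rank_cycle_cyclic_rank[OF assms])
qed

lemma rank_cycle_cyclic:
  assumes "n > 0" and "\<pi> permutes {1..n}"
  shows "rank_cycle n \<pi> \<in> cyclic_perms n"
proof -
  have "rank_cycle n \<pi> ` {1..n} \<subseteq> {1..n}"
    using cyclic_rank_in[OF assms] by (auto simp: rank_cycle_def simp del: atLeastAtMost_iff)
  then have "bij_betw (rank_cycle n \<pi>) {1..n} {1..n}"
    using rank_cycle_inj_on[OF assms] by (simp add: bij_betw_def endo_inj_surj)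
  then have "rank_cycle n \<pi> permutes {1..n}"
    by (rule bij_imp_permutes) (auto simp: rank_cycle_def)
  moreover have "orbit (rank_cycle n \<pi>) (\<pi> 1) = {1..n}"
  proof
    show "orbit (rank_cycle n \<pi>) (\<pi> 1) \<subseteq> {1..n}"
      using cyclic_rank_in[OF assms]
      by (auto simp: orbit_altdef funpow_rank_cycle[OF assms] simp del: atLeastAtMost_iff One_nat_def)
    show "{1..n} \<subseteq> orbit (rank_cycle n \<pi>) (\<pi> 1)"
    proof
      fix x assume "x \<in> {1..n}"
      then obtain i where "x = cyclic_rank n \<pi> i"
        using cyclic_rank_surj[OF assms] by metis
      \<comment> \<open>\<open>orbit\<close> uses positive exponents only, so \<open>i\<close>,
        which may be 0, is replaced by \<open>i + n\<close>.\<close>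
      also have "\<dots> = cyclic_rank n \<pi> (i + n)"
        using cyclic_rank_add_mult[of n \<pi> i 1] by simp
      also have "\<dots> = (rank_cycle n \<pi> ^^ (i + n)) (\<pi> 1)"
        by (simp only: funpow_rank_cycle[OF assms])
      finally show "x \<in> orbit (rank_cycle n \<pi>) (\<pi> 1)"
        using assms(1) by (auto simp: orbit_altdef simp del: One_nat_def)
    qed
  qed
  moreover have "\<pi> 1 \<in> {1..n}"
    using cyclic_rank_in[OF assms, of 0] by (simp add: cyclic_rank_def)
  ultimately show ?thesis
    by (auto simp: cyclic_on_def)
qed

text \<open>A repetition among the first \<open>n\<close> iterates would give a period below
  \<open>n\<close>, and the orbit, which is all of \<open>{1..n}\<close>, would have fewer than
  \<open>n\<close> elements.\<close>

lemma inj_on_funpow_cyclic: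
  assumes perm: "\<tau> permutes {1..n}" and cyc: "cyclic_on \<tau> {1..n}" and x: "x \<in> {1..n}"
  shows "inj_on (\<lambda>i. (\<tau> ^^ i) x) {..<n}"
proof (rule linorder_inj_onI')
  fix i j assume ij: "i \<in> {..<n}" "j \<in> {..<n}" "i < j"
  show "(\<tau> ^^ i) x \<noteq> (\<tau> ^^ j) x"
  proof
    assume "(\<tau> ^^ i) x = (\<tau> ^^ j) x"
    also have "(\<tau> ^^ j) x = (\<tau> ^^ i) ((\<tau> ^^ (j - i)) x)"
      using ij by (metis add_diff_inverse_nat comp_apply funpow_add less_imp_not_less)
    finally have "x = (\<tau> ^^ (j - i)) x"
      using inj_fn[OF permutes_inj[OF perm]] by (simp add: inj_eq)
    then have per: "(\<tau> ^^ (m mod (j - i))) x = (\<tau> ^^ m) x" for m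
      by (intro funpow_mod_eq) simp
    have "{1..n} = orbit \<tau> x"
      using orbit_cyclic_eq3[OF cyc x] by simp
    also have "\<dots> \<subseteq> (\<lambda>m. (\<tau> ^^ m) x) ` {..<j - i}"
    proof
      fix y assume "y \<in> orbit \<tau> x"
      then obtain m where "y = (\<tau> ^^ m) x"
        by (auto simp: orbit_altdef)
      then show "y \<in> (\<lambda>m. (\<tau> ^^ m) x) ` {..<j - i}"
        using per[of m] ij by (intro image_eqI[of _ _ "m mod (j - i)"]) auto
    qed
    finally have "card {1..n} \<le> card {..<j - i}"
      by (rule surj_card_le[OF finite_lessThan])
    then show False
      using ij by auto
  qed
qed

text \<open>The cycle can be written starting at any of its \<open>n\<close> elements:
  \<open>\<pi> 1\<close> is free, and the other values of \<open>\<pi>\<close> are the iterates of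
  \<open>\<tau>\<close> at it.\<close>

lemma card_rank_cycle_fibre:
  assumes n: "n > 0" and \<tau>: "\<tau> \<in> cyclic_perms n"
  shows "card {\<pi> \<in> perms n. rank_cycle n \<pi> = \<tau>} = n"
proof -
  have perm: "\<tau> permutes {1..n}" and cyc: "cyclic_on \<tau> {1..n}"
    using \<tau> by auto
  let ?p = "\<lambda>x y. if y \<in> {1..n} then (\<tau> ^^ (y - 1)) x else y"
  note inj = inj_on_funpow_cyclic[OF perm cyc]
  have funpow_in: "(\<tau> ^^ i) x \<in> {1..n}" if "x \<in> {1..n}" for i x
    by (rule cyclic_on_funpow_in[OF cyc that])
  \<comment> \<open>The first \<open>n\<close> iterates fill \<open>{1..n}\<close>, so the
    \<open>n\<close>-th equals some \<open>j\<close>-th with \<open>j < n\<close>. For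
    \<open>j > 0\<close>, cancelling one \<open>\<tau>\<close> would contradict injectivity.\<close>
  have funpow_n: "(\<tau> ^^ n) x = x" if x: "x \<in> {1..n}" for x
  proof -
    have "(\<lambda>i. (\<tau> ^^ i) x) ` {..<n} = {1..n}"
    proof (rule card_subset_eq)
      show "(\<lambda>i. (\<tau> ^^ i) x) ` {..<n} \<subseteq> {1..n}"
        using funpow_in[OF x] by blast
      show "card ((\<lambda>i. (\<tau> ^^ i) x) ` {..<n}) = card {1..n}"
        using card_image[OF inj[OF x]] by simp
    qed simp
    then have "(\<tau> ^^ n) x \<in> (\<lambda>i. (\<tau> ^^ i) x) ` {..<n}"
      using funpow_in[OF x, of n] by simp
    then obtain j where j: "j < n" "(\<tau> ^^ n) x = (\<tau> ^^ j) x"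
      by blast
    have "j = 0"
    proof (rule ccontr)
      assume "j \<noteq> 0"
      then obtain j' where j': "j = Suc j'"
        by (cases j) auto
      have "\<tau> ((\<tau> ^^ (n - 1)) x) = \<tau> ((\<tau> ^^ j') x)"
        using j n unfolding j' by (cases n) auto
      then have "(\<tau> ^^ (n - 1)) x = (\<tau> ^^ j') x"
        using permutes_inj[OF perm] by (simp add: inj_eq)
      then have "n - 1 = j'"
        using inj_onD[OF inj[OF x], of "n - 1" j'] n j j' by auto
      then show False
        using j j' n by simp
    qed
    then show ?thesis
      using j by simp
  qed
  have "bij_betw (\<lambda>\<pi>. \<pi> 1) {\<pi> \<in> perms n. rank_cycle n \<pi> = \<tau>} {1..n}"
  proof (rule bij_betw_byWitness[where f' = ?p])
    show "\<forall>\<pi>\<in>{\<pi> \<in> perms n. rank_cycle n \<pi> = \<tau>}. ?p (\<pi> 1) = \<pi>"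
    proof
      fix \<pi> assume "\<pi> \<in> {\<pi> \<in> perms n. rank_cycle n \<pi> = \<tau>}"
      then have \<pi>: "\<pi> permutes {1..n}" "\<tau> = rank_cycle n \<pi>"
        by auto
      show "?p (\<pi> 1) = \<pi>"
      proof
        fix y
        show "?p (\<pi> 1) y = \<pi> y"
        proof (cases "y \<in> {1..n}")
          case True
          then have "(\<tau> ^^ (y - 1)) (\<pi> 1) = cyclic_rank n \<pi> (y - 1)"
            unfolding \<pi>(2) by (intro funpow_rank_cycle[OF n \<pi>(1)])
          also have "\<dots> = \<pi> y"
            using True by (auto simp: cyclic_rank_def)
          finally show ?thesis
            using True by simp
        next
          case False
          then show ?thesis
            using permutes_not_in[OF \<pi>(1) False] by auto
        qed
      qed
    qed
    show "\<forall>x\<in>{1..n}. ?p x 1 = x"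
      by simp
    show "(\<lambda>\<pi>. \<pi> 1) ` {\<pi> \<in> perms n. rank_cycle n \<pi> = \<tau>} \<subseteq> {1..n}"
    proof
      fix x assume "x \<in> (\<lambda>\<pi>. \<pi> 1) ` {\<pi> \<in> perms n. rank_cycle n \<pi> = \<tau>}"
      then obtain \<pi> where "\<pi> permutes {1..n}" "x = \<pi> 1"
        by blast
      then show "x \<in> {1..n}"
        using n permutes_in_image[of \<pi> "{1..n}" 1] by simp
    qed
    show "?p ` {1..n} \<subseteq> {\<pi> \<in> perms n. rank_cycle n \<pi> = \<tau>}"
    proof
      fix \<pi> assume "\<pi> \<in> ?p ` {1..n}"
      then obtain x where x: "x \<in> {1..n}" and \<pi>: "\<pi> = ?p x"
        by blast
      have "inj_on \<pi> {1..n}"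
      proof (rule inj_onI)
        fix y z assume yz: "y \<in> {1..n}" "z \<in> {1..n}" "\<pi> y = \<pi> z"
        then have "(\<tau> ^^ (y - 1)) x = (\<tau> ^^ (z - 1)) x"
          by (simp add: \<pi>)
        moreover have "y - 1 \<in> {..<n}" "z - 1 \<in> {..<n}"
          using yz by auto
        ultimately have "y - 1 = z - 1"
          by (rule inj_onD[OF inj[OF x]])
        then show "y = z"
          using yz by auto
      qed
      moreover have "\<pi> ` {1..n} \<subseteq> {1..n}"
        using funpow_in[OF x] by (auto simp: \<pi> simp del: atLeastAtMost_iff)
      ultimately have "bij_betw \<pi> {1..n} {1..n}"
        by (simp add: bij_betw_def endo_inj_surj)
      then have \<pi>_perm: "\<pi> permutes {1..n}"
        by (rule bij_imp_permutes) (auto simp: \<pi>)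
      have q: "cyclic_rank n \<pi> i = (\<tau> ^^ i) x" for i
      proof -
        have "cyclic_rank n \<pi> i = (\<tau> ^^ (i mod n)) x"
          using n by (auto simp: cyclic_rank_def \<pi> Suc_le_eq)
        also have "\<dots> = (\<tau> ^^ i) x"
          by (rule funpow_mod_eq[OF funpow_n[OF x]])
        finally show ?thesis .
      qed
      have "rank_cycle n \<pi> y = \<tau> y" for y
      proof (cases "y \<in> {1..n}")
        case True
        then obtain i where "y = cyclic_rank n \<pi> i"
          using cyclic_rank_surj[OF n \<pi>_perm] by metis
        then show ?thesis
          using rank_cycle_cyclic_rank[OF n \<pi>_perm, of i] by (simp add: q)
      next
        case False
        then show ?thesis
          using permutes_not_in[OF perm False] by (auto simp: rank_cycle_def)
      qed
      then show "\<pi> \<in> {\<pi> \<in> perms n. rank_cycle n \<pi> = \<tau>}"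
        using \<pi>_perm by auto
    qed
  qed
  then show ?thesis
    by (simp add: bij_betw_same_card)
qed

section \<open>Counting words and patterns by cyclic permutations\<close>

lemma finite_perms: "finite (perms n)"
  by (simp add: finite_permutations)

lemma finite_cyclic_perms: "finite (cyclic_perms n)"
  by (rule finite_subset[OF _ finite_perms]) auto

text \<open>All fibres of \<open>rank_cycle\<close> have \<open>n\<close> elements. The factor
  \<open>n\<close> obtained here cancels the division by \<open>n\<close> in
  \<open>num_periodic_patterns\<close> and \<open>primitive_necklaces\<close>.\<close>

lemma sum_rank_cycle:
  fixes h :: "(nat \<Rightarrow> nat) \<Rightarrow> nat"
  assumes "n > 0"
  shows "(\<Sum>\<pi>\<in>perms n. h (rank_cycle n \<pi>)) = n * (\<Sum>\<tau>\<in>cyclic_perms n. h \<tau>)"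
proof -
  have "(\<Sum>\<pi>\<in>perms n. h (rank_cycle n \<pi>)) =
      (\<Sum>\<tau>\<in>cyclic_perms n. \<Sum>\<pi> | \<pi> \<in> perms n \<and> rank_cycle n \<pi> = \<tau>. h (rank_cycle n \<pi>))"
    using rank_cycle_cyclic[OF assms]
    by (intro sum.group[symmetric] finite_perms finite_cyclic_perms) blast
  also have "\<dots> = (\<Sum>\<tau>\<in>cyclic_perms n. n * h \<tau>)"
  proof (rule sum.cong[OF refl])
    fix \<tau> assume \<tau>: "\<tau> \<in> cyclic_perms n"
    have "(\<Sum>\<pi> | \<pi> \<in> perms n \<and> rank_cycle n \<pi> = \<tau>. h (rank_cycle n \<pi>)) =
        (\<Sum>\<pi> | \<pi> \<in> perms n \<and> rank_cycle n \<pi> = \<tau>. h \<tau>)"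
      by (rule sum.cong) auto
    also have "\<dots> = n * h \<tau>"
      using card_rank_cycle_fibre[OF assms \<tau>] by simp
    finally show "(\<Sum>\<pi> | \<pi> \<in> perms n \<and> rank_cycle n \<pi> = \<tau>. h (rank_cycle n \<pi>)) = n * h \<tau>" .
  qed
  finally show ?thesis
    by (simp add: sum_distrib_left)
qed

lemma finite_periodic_words:
  assumes "n > 0"
  shows "finite (periodic_words k n)"
  using card_streams_period(1)[OF assms, of k]
  by (rule rev_finite_subset) (auto simp: periodic_words_eq[OF assms])

text \<open>Words are sorted by pattern; the size of a fibre depends on the pattern only through the
  descents of its rank cycle.\<close>

lemma card_periodic_words_eq_sum:
  assumes "n > 0"
  shows "card (periodic_words k n) =
    n * (\<Sum>\<tau>\<in>cyclic_perms n. (n + k - 1 - card (descents n \<tau>)) choose n)"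
proof -
  have "card (periodic_words k n) = (\<Sum>s\<in>periodic_words k n. 1)"
    by simp
  also have "\<dots> = (\<Sum>\<pi>\<in>perms n. \<Sum>s | s \<in> periodic_words k n \<and> pattern (k_shift k) n s = \<pi>. 1)"
    using pattern_eq_iff[OF assms]
    by (intro sum.group[symmetric] finite_perms finite_periodic_words assms) (auto simp: pattern_of_def)
  also have "\<dots> = (\<Sum>\<pi>\<in>perms n. card {s \<in> periodic_words k n. pattern_of n s \<pi>})"
    using pattern_eq_iff[OF assms] by (intro sum.cong) (auto intro!: arg_cong[of _ _ card])
  also have "\<dots> = (\<Sum>\<pi>\<in>perms n. (n + k - 1 - card (descents n (rank_cycle n \<pi>))) choose n)"
    using card_pattern_fibre[OF assms] by (intro sum.cong) auto
  also have "\<dots> = n * (\<Sum>\<tau>\<in>cyclic_perms n. (n + k - 1 - card (descents n \<tau>)) choose n)"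
    by (rule sum_rank_cycle[OF assms])
  finally show ?thesis .
qed

text \<open>A permutation is a pattern iff its fibre of words is nonempty, that is, iff the binomial
  coefficient counting the fibre is positive.\<close>

lemma card_periodic_patterns:
  assumes "n > 0"
  shows "card (periodic_patterns (k_shift k) n) =
    n * card {\<tau> \<in> cyclic_perms n. card (descents n \<tau>) + 1 \<le> k}"
proof -
  have des: "card (descents n \<tau>) < n" for \<tau>
    using card_mono[OF _ descents_subset[of n \<tau>]] assms by simp
  have "periodic_patterns (k_shift k) n =
      {\<pi> \<in> perms n. card (descents n (rank_cycle n \<pi>)) + 1 \<le> k}"
  proof (rule set_eqI)
    fix \<pi>
    have "\<pi> \<in> periodic_patterns (k_shift k) n \<longleftrightarrow>
        \<pi> \<in> perms n \<and> {s \<in> periodic_words k n. pattern_of n s \<pi>} \<noteq> {}"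
    proof -
      have "\<pi> \<in> periodic_patterns (k_shift k) n \<longleftrightarrow>
          (\<exists>s\<in>periodic_words k n. pattern (k_shift k) n s = \<pi>)"
        by (auto simp: periodic_patterns_def k_shift_def)
      also have "\<dots> \<longleftrightarrow> (\<exists>s\<in>periodic_words k n. pattern_of n s \<pi>)"
        using pattern_eq_iff[OF assms] by blast
      finally show ?thesis
        by (auto simp: pattern_of_def)
    qed
    also have "\<dots> \<longleftrightarrow> \<pi> \<in> perms n \<and> card {s \<in> periodic_words k n. pattern_of n s \<pi>} > 0"
      using finite_periodic_words[OF assms, of k] by (auto simp: card_gt_0_iff)
    also have "\<dots> \<longleftrightarrow> \<pi> \<in> perms n \<and> n \<le> n + k - 1 - card (descents n (rank_cycle n \<pi>))"
      using card_pattern_fibre[OF assms, of \<pi> k] by (auto simp: zero_less_binomial_iff)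
    also have "\<dots> \<longleftrightarrow> \<pi> \<in> {\<pi> \<in> perms n. card (descents n (rank_cycle n \<pi>)) + 1 \<le> k}"
      using des[of "rank_cycle n \<pi>"] by auto
    finally show "\<pi> \<in> periodic_patterns (k_shift k) n \<longleftrightarrow>
        \<pi> \<in> {\<pi> \<in> perms n. card (descents n (rank_cycle n \<pi>)) + 1 \<le> k}" .
  qed
  then have "card (periodic_patterns (k_shift k) n) =
      (\<Sum>\<pi>\<in>perms n. if card (descents n (rank_cycle n \<pi>)) + 1 \<le> k then 1 else 0)"
    by (simp add: sum.inter_filter[symmetric] finite_permutations)
  also have "\<dots> = n * (\<Sum>\<tau>\<in>cyclic_perms n. if card (descents n \<tau>) + 1 \<le> k then 1 else 0)"
    by (rule sum_rank_cycle[OF assms])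
  also have "\<dots> = n * card {\<tau> \<in> cyclic_perms n. card (descents n \<tau>) + 1 \<le> k}"
    by (simp only: card_eq_sum sum.inter_filter[OF finite_cyclic_perms])
  finally show ?thesis .
qed

section \<open>The difference formula and the recurrence\<close>

text \<open>A permutation without descents is increasing, so it satisfies
  \<open>x \<le> \<tau> x\<close> and fixes \<open>n\<close>; a cycle on at least two points has no
  fixed point.\<close>

lemma num_cyclic_desc_1:
  assumes "n \<ge> 2"
  shows "num_cyclic_desc n 1 = 0"
proof -
  have False if \<tau>: "\<tau> permutes {1..n}" "cyclic_on \<tau> {1..n}" and des: "card (descents n \<tau>) = 0" for \<tau>
  proof -
    have "descents n \<tau> = {}"
      using des finite_subset[OF descents_subset[of n \<tau>]] by simp
    then have step: "\<tau> x < \<tau> (Suc x)" if "1 \<le> x" "x < n" for x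
    proof -
      have "\<tau> x \<le> \<tau> (Suc x)"
      proof -
        have "x \<notin> descents n \<tau>" "x \<in> {1..n - 1}"
          using \<open>descents n \<tau> = {}\<close> that by auto
        then show ?thesis
          by (simp add: descents_def)
      qed
      moreover have "\<tau> x \<noteq> \<tau> (Suc x)"
        using permutes_inj[OF \<tau>(1)] by (simp add: inj_eq)
      ultimately show ?thesis
        by simp
    qed
    have ge: "x \<le> \<tau> x" if "1 \<le> x" "x \<le> n" for x
      using that
    proof (induction x rule: dec_induct)
      case base
      then show ?case
        using permutes_in_image[OF \<tau>(1), of 1] by simp
    next
      case (step x)
      then show ?case
        using \<open>\<And>x. 1 \<le> x \<Longrightarrow> x < n \<Longrightarrow> \<tau> x < \<tau> (Suc x)\<close>[of x] by simp
    qed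
    then have "\<tau> n = n"
      using permutes_in_image[OF \<tau>(1), of n] assms by (intro antisym) auto
    then have "orbit \<tau> n = {n}"
      by (simp add: orbit_eq_singleton_iff)
    moreover have "orbit \<tau> n = {1..n}"
      using assms by (intro orbit_cyclic_eq3[OF \<tau>(2)]) auto
    ultimately have "card {1..n} = card {n}"
      by simp
    then show False
      using assms by simp
  qed
  then have "{\<tau>. \<tau> permutes {1..n} \<and> cyclic_on \<tau> {1..n} \<and> card (descents n \<tau>) + 1 = 1} = {}"
    by auto
  then show ?thesis
    unfolding num_cyclic_desc_def by (simp only: card.empty)
qed

text \<open>Each side of the difference counts the cycles below a bound on descents; raising the
  bound by one adds exactly those with \<open>k - 1\<close> descents.\<close>

lemma num_periodic_patterns_diff:
  assumes "n > 0" and "k > 0"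
  shows "num_periodic_patterns (k_shift k) n - num_periodic_patterns (k_shift (k - 1)) n =
    real (num_cyclic_desc n k)"
proof -
  let ?S = "\<lambda>k. {\<tau> \<in> cyclic_perms n. card (descents n \<tau>) + 1 \<le> k}"
  let ?T = "{\<tau>. \<tau> permutes {1..n} \<and> cyclic_on \<tau> {1..n} \<and> card (descents n \<tau>) + 1 = k}"
  have "num_periodic_patterns (k_shift m) n = real (card (?S m))" for m
    using assms by (simp add: num_periodic_patterns_def card_periodic_patterns)
  moreover have "card (?S k) = card (?S (k - 1)) + card ?T"
  proof -
    have fin: "finite (?S (k - 1))" "finite ?T"
      by (rule finite_subset[OF _ finite_cyclic_perms[of n]]; blast)+
    have "?S k = ?S (k - 1) \<union> ?T"
      using assms(2) by auto
    moreover have "card (?S (k - 1) \<union> ?T) = card (?S (k - 1)) + card ?T"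
      by (rule card_Un_disjoint[OF fin]) (use assms(2) in auto)
    ultimately show ?thesis
      by (rule trans[OF arg_cong])
  qed
  ultimately show ?thesis
    by (simp add: num_cyclic_desc_def)
qed

text \<open>Two counts of the primitive words are compared: Moebius inversion on one side, and on
  the other the sum over cycles, grouped by number of descents.\<close>

lemma primitive_necklaces_eq_sum:
  assumes "n \<ge> 2" and "k \<ge> 2"
  shows "primitive_necklaces k n =
    (\<Sum>i = 2..k. real ((n + k - i) choose (k - i)) * real (num_cyclic_desc n i))"
proof -
  have n: "n > 0"
    using assms by simp
  have des: "card (descents n \<tau>) < n" for \<tau>
    using card_mono[OF _ descents_subset[of n \<tau>]] n by simp
  let ?f = "\<lambda>i. ((n + k - i) choose n) * num_cyclic_desc n i"
  have "real n * primitive_necklaces k n =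
      real n * real (\<Sum>\<tau>\<in>cyclic_perms n. (n + k - 1 - card (descents n \<tau>)) choose n)"
    using card_periodic_words[OF n, of k] card_periodic_words_eq_sum[OF n, of k] by (metis of_nat_mult)
  then have "primitive_necklaces k n =
      real (\<Sum>\<tau>\<in>cyclic_perms n. (n + k - 1 - card (descents n \<tau>)) choose n)"
    using n by simp
  \<comment> \<open>The index \<open>i\<close> is the number of descents plus one, hence at most
    \<open>n\<close>. The range up to \<open>n + k\<close> contains all these values as well as
    \<open>{2..k}\<close>.\<close>
  also have "(\<Sum>\<tau>\<in>cyclic_perms n. (n + k - 1 - card (descents n \<tau>)) choose n) =
      (\<Sum>i\<in>{..n + k}. \<Sum>\<tau> | \<tau> \<in> cyclic_perms n \<and> card (descents n \<tau>) + 1 = i.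
         (n + k - 1 - card (descents n \<tau>)) choose n)"
    using des by (intro sum.group[symmetric] finite_cyclic_perms) (auto simp: Suc_le_eq trans_less_add1)
  also have "\<dots> = (\<Sum>i\<in>{..n + k}. ?f i)"
  proof (rule sum.cong[OF refl])
    fix i
    have "(\<Sum>\<tau> | \<tau> \<in> cyclic_perms n \<and> card (descents n \<tau>) + 1 = i.
        (n + k - 1 - card (descents n \<tau>)) choose n) =
      (\<Sum>\<tau> | \<tau> \<in> cyclic_perms n \<and> card (descents n \<tau>) + 1 = i. (n + k - i) choose n)"
      by (rule sum.cong) auto
    also have "\<dots> = ?f i"
      by (simp add: num_cyclic_desc_def conj_assoc)
    finally show "(\<Sum>\<tau> | \<tau> \<in> cyclic_perms n \<and> card (descents n \<tau>) + 1 = i.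
        (n + k - 1 - card (descents n \<tau>)) choose n) = ?f i" .
  qed
  also have "\<dots> = (\<Sum>i = 2..k. ?f i)"
  proof (rule sum.mono_neutral_right)
    \<comment> \<open>No cycle has index 0 or 1, and for \<open>i > k\<close> the upper entry of the
      binomial coefficient is below \<open>n\<close>.\<close>
    show "\<forall>i\<in>{..n + k} - {2..k}. ?f i = 0"
    proof
      fix i assume i: "i \<in> {..n + k} - {2..k}"
      then consider "i = 0" | "i = 1" | "i > k"
        by force
      then show "?f i = 0"
      proof cases
        case 3
        then show ?thesis
          using i by (auto intro!: binomial_eq_0)
      qed (use num_cyclic_desc_1[OF assms(1)] in \<open>simp_all add: num_cyclic_desc_def\<close>)
    qed
  qed auto
  also have "real \<dots> = (\<Sum>i = 2..k. real ((n + k - i) choose (k - i)) * real (num_cyclic_desc n i))"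
    unfolding of_nat_sum
  proof (rule sum.cong[OF refl])
    fix i assume "i \<in> {2..k}"
    then have "(n + k - i) choose n = (n + k - i) choose (k - i)"
      by (subst binomial_symmetric) auto
    then show "real (?f i) = real ((n + k - i) choose (k - i)) * real (num_cyclic_desc n i)"
      by simp
  qed
  finally show ?thesis .
qed

theorem theorem3p8:
  fixes k n :: nat
  assumes "k \<ge> 3" and "n \<ge> 2"
  shows "num_periodic_patterns (k_shift k) n - num_periodic_patterns (k_shift (k - 1)) n
           = real (num_cyclic_desc n k)
       \<and> real (num_cyclic_desc n k)
           = primitive_necklaces k n
             - (\<Sum>i = 2..k - 1. real ((n + k - i) choose (k - i)) * real (num_cyclic_desc n i))"
proof
  show "num_periodic_patterns (k_shift k) n - num_periodic_patterns (k_shift (k - 1)) n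
      = real (num_cyclic_desc n k)"
    using assms by (intro num_periodic_patterns_diff) auto
  \<comment> \<open>The term \<open>i = k\<close> has the coefficient \<open>n choose 0 = 1\<close>,
    so splitting it off solves the identity for \<open>num_cyclic_desc n k\<close>.\<close>
  have "{2..k} = insert k {2..k - 1}"
    using assms by auto
  then have "primitive_necklaces k n = real (num_cyclic_desc n k) +
      (\<Sum>i = 2..k - 1. real ((n + k - i) choose (k - i)) * real (num_cyclic_desc n i))"
    using assms by (subst primitive_necklaces_eq_sum) auto
  then show "real (num_cyclic_desc n k) = primitive_necklaces k n
      - (\<Sum>i = 2..k - 1. real ((n + k - i) choose (k - i)) * real (num_cyclic_desc n i))"
    by simp
qed

end
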